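(* Let $k\geq 2$ be an integer and let $P_k(n)$ denote the number of privileged words of length $n$ over the alphabet $\Sigma_k=\{0,1,\ldots,k-1\}$. Define $\log_k^{\circ 0}(n)=n$ and $\log_k^{\circ j}(n)=\log_k(\log_k^{\circ j-1}(n))$ for $j\geq 1$ (empty products equal $1$). (a) For every integer $j\geq 0$ there exist constants $N_j>0$ and $c_j>0$ such that \[P_k(n)\geq c_j\frac{k^n}{n\,\log_k^{\circ j}(n)\prod_{i=1}^{j}\log_k^{\circ i}(n)}\quad\text{for all } n>N_j.\] (b) For every integer $j\geq 0$ there exist constants $N_j'>0$ and $c_j'>0$ such that \[P_k(n)\leq c_j'\frac{k^n}{n\prod_{i=1}^{j}\log_k^{\circ i}(n)}\quad\text{for all } n>N_j'.\]
   Context: A word $u$ is a factor of a word $w$ if $w=xuy$ for some words $x,y$; occurrences are counted as factor positions (overlaps allowed). A border of a word $w$ is a non-empty word $u$ that is both a proper prefix and a proper suffix of $w$. A word $w$ is closed by a word $u$ if $u$ is a border of $w$ and $u$ occurs exactly twice in $w$. A word $w$ is privileged if $|w|\leq 1$ or if $w$ is closed by some privileged word (a recursive definition on length). *)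

theory Defs
  imports "HOL-Analysis.Analysis"
begin

definition occ_count :: "'a list \<Rightarrow> 'a list \<Rightarrow> nat" where
  "occ_count u w = card {i. i + length u \<le> length w \<and> take (length u) (drop i w) = u}"

definition is_border :: "'a list \<Rightarrow> 'a list \<Rightarrow> bool" where
  "is_border u w \<longleftrightarrow> u \<noteq> [] \<and> length u < length w \<and> (\<exists>y. w = u @ y) \<and> (\<exists>x. w = x @ u)"

definition closed_by :: "'a list \<Rightarrow> 'a list \<Rightarrow> bool" where
  "closed_by w u \<longleftrightarrow> is_border u w \<and> occ_count u w = 2"

inductive privileged :: "'a list \<Rightarrow> bool" where
  short: "length w \<le> 1 \<Longrightarrow> privileged w"
| closed: "privileged u \<Longrightarrow> closed_by w u \<Longrightarrow> privileged w"

definition words :: "nat \<Rightarrow> nat \<Rightarrow> nat list set" where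
  "words k n = {w. length w = n \<and> set w \<subseteq> {0..<k}}"

definition P :: "nat \<Rightarrow> nat \<Rightarrow> nat" where
  "P k n = card {w \<in> words k n. privileged w}"

definition iterlog :: "nat \<Rightarrow> nat \<Rightarrow> real \<Rightarrow> real" where
  "iterlog k j x = ((\<lambda>y. log (real k) y) ^^ j) x"

end

(*
Every privileged word w of length n >= 2 is closed by a privileged word u, and the count is governed
by |u| = t close to log_k n.  For such t the number of words closed by u is of order
k^(n - 2t): a union bound gives the lower bound (when u has neither period 1 nor period 2), and
splitting the middle part into blocks of length 2t, each containing u with probability at least
t / (2 k^t), gives the upper bound k^(n - 2t) exp(- n / (8 k^t)) for every u.  Hence P_k(n) / k^n is
comparable with P_k(t) / (n k^t), t = log_k n, and each bound improves itself by one more iterated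
logarithm.
*)
theory Submission
  imports Defs "HOL-Real_Asymp.Real_Asymp"
begin

section \<open>Occurrences\<close>

text \<open>Both bounds iterate the same recursion but start from different trivial facts. The lower
  bound starts from the existence of one suitable border, a share 1 / k^t of all words of length t,
  which gives only k^n / n^2. The upper bound starts from \<open>P k n \<le> k ^ n\<close>. This is
  why the innermost iterated logarithm is squared in (a) and not in (b).

  The obstacle in the lower bound is self-overlap. For k = 2, a third occurrence shifted by d from
  an end of the word can have conditional probability 2^(-d), and summing this over all d \<ge> 1 at
  both ends exceeds 1. Without the shifts 1 and 2 each end contributes at most 1/4. The positions
  away from both ends contribute another 1/4 once k^t \<ge> 4n, so a quarter of the words survives.
  Borders must satisfy the same restriction, so the recursion runs on privileged words without these
  periods.

  The lower bound may choose one convenient t, but the upper bound must sum over all border lengths,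
  very short ones included. Its induction therefore carries a bound valid for every n \<ge> 1
  instead of an asymptotic one.\<close>

definition occurs_at :: "'a list \<Rightarrow> 'a list \<Rightarrow> nat \<Rightarrow> bool" where
  "occurs_at u w i \<longleftrightarrow> i + length u \<le> length w \<and> (\<forall>j<length u. w ! (i + j) = u ! j)"

lemma occurs_at_iff_take_drop:
  "occurs_at u w i \<longleftrightarrow> i + length u \<le> length w \<and> take (length u) (drop i w) = u"
  unfolding occurs_at_def by (auto simp: list_eq_iff_nth_eq)

lemma occurs_at_nth:
  assumes "occurs_at u w i" "i \<le> j" "j < i + length u"
  shows "w ! j = u ! (j - i)"
  using assms unfolding occurs_at_def by (metis add_less_imp_less_left le_add_diff_inverse)

lemma occurs_at_append_right: "occurs_at u v i \<Longrightarrow> occurs_at u (v @ y) i"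
  unfolding occurs_at_def by (auto simp: nth_append)

lemma occurs_at_append_left: "occurs_at u v i \<Longrightarrow> occurs_at u (x @ v) (length x + i)"
  unfolding occurs_at_def by (auto simp: nth_append)

lemma is_border_iff:
  "is_border u w \<longleftrightarrow> u \<noteq> [] \<and> length u < length w \<and>
     occurs_at u w 0 \<and> occurs_at u w (length w - length u)"
proof -
  have "(\<exists>y. w = u @ y) \<longleftrightarrow> take (length u) w = u"
    by (metis append_eq_conv_conj)
  moreover have "(\<exists>x. w = x @ u) \<longleftrightarrow> drop (length w - length u) w = u" if "length u < length w"
    by (metis append_eq_conv_conj append_take_drop_id diff_add_inverse2 length_append)
  ultimately show ?thesis
    unfolding is_border_def occurs_at_iff_take_drop by auto
qed

text \<open>A border already occurs at the two distinct positions \<open>0\<close> and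
  \<open>length w - length u\<close>, so a count of two leaves room for no other position.\<close>

lemma closed_by_iff:
  "closed_by w u \<longleftrightarrow> u \<noteq> [] \<and> length u < length w \<and>
     (\<forall>i. occurs_at u w i \<longleftrightarrow> i = 0 \<or> i = length w - length u)"
proof (cases "is_border u w")
  case True
  let ?S = "{i. occurs_at u w i}" and ?T = "{0, length w - length u}"
  have "finite ?S"
    by (rule finite_subset[of _ "{..length w}"]) (auto simp: occurs_at_def)
  moreover have "?T \<subseteq> ?S" "card ?T = 2"
    using True by (auto simp: is_border_iff)
  ultimately have "card ?S = 2 \<longleftrightarrow> ?S = ?T"
    by (metis card_subset_eq)
  moreover have "occ_count u w = card ?S"
    unfolding occ_count_def by (simp add: occurs_at_iff_take_drop)
  ultimately show ?thesis
    using True by (auto simp: closed_by_def is_border_iff)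
next
  case False
  then show ?thesis
    by (auto simp: closed_by_def is_border_iff)
qed

lemma closed_byD:
  assumes "closed_by w u"
  shows "u \<noteq> []" "length u < length w" "occurs_at u w 0" "occurs_at u w (length w - length u)"
  using assms by (auto simp: closed_by_iff)

lemma closed_by_take:
  assumes "closed_by w u"
  shows "take (length u) w = u"
  using closed_byD(3)[OF assms] by (simp add: occurs_at_iff_take_drop)

section \<open>Counting words\<close>

lemma finite_words [simp]: "finite (words k n)"
  using finite_lists_length_eq[of "{0..<k}" n] by (simp add: words_def conj_commute)

lemma card_words: "card (words k n) = k ^ n"
  using card_lists_length_eq[of "{0..<k}" n] by (simp add: words_def conj_commute)

lemma words_nth: "w \<in> words k n \<Longrightarrow> i < n \<Longrightarrow> w ! i < k"
  unfolding words_def using nth_mem by fastforce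

text \<open>A word of \<open>X\<close> is determined by its letters outside \<open>F\<close>, with
  at most \<open>k\<close> choices for each.\<close>

lemma card_words_agreeing_le:
  assumes "X \<subseteq> words k n" "F \<subseteq> {..<n}"
    and agree: "\<And>w w' j. w \<in> X \<Longrightarrow> w' \<in> X \<Longrightarrow> j \<in> F \<Longrightarrow> w ! j = w' ! j"
  shows "card X \<le> k ^ (n - card F)"
proof -
  let ?J = "{..<n} - F"
  have "card X \<le> card (PiE ?J (\<lambda>_. {0..<k}))"
  proof (rule card_inj_on_le)
    show "inj_on (\<lambda>w. restrict (nth w) ?J) X"
    proof (rule inj_onI)
      fix w w' assume X: "w \<in> X" "w' \<in> X" and eq: "restrict (nth w) ?J = restrict (nth w') ?J"
      have "w ! j = w' ! j" if "j < n" for j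
        using agree[OF X] fun_cong[OF eq, of j] that by (cases "j \<in> F") auto
      then show "w = w'"
        using X assms(1) by (auto simp: words_def intro!: nth_equalityI)
    qed
    show "(\<lambda>w. restrict (nth w) ?J) ` X \<subseteq> PiE ?J (\<lambda>_. {0..<k})"
      using assms(1) words_nth by (auto simp: PiE_iff subset_iff)
  qed (auto intro: finite_PiE)
  also have "\<dots> = k ^ card ?J"
    by (simp add: card_PiE)
  also have "card ?J = n - card F"
    using assms(2) by (simp add: card_Diff_subset finite_subset)
  finally show ?thesis .
qed

text \<open>Every letter covered by one of the prescribed copies is forced. Overlapping copies force
  fewer letters, which is why the size of the union of the windows appears.\<close>

lemma card_words_occurrences_le:
  assumes "\<And>i. i \<in> I \<Longrightarrow> i + length u \<le> n"
  shows "card {w \<in> words k n. \<forall>i\<in>I. occurs_at u w i}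
           \<le> k ^ (n - card (\<Union>i\<in>I. {i..<i + length u}))"
proof (rule card_words_agreeing_le)
  show "(\<Union>i\<in>I. {i..<i + length u}) \<subseteq> {..<n}"
    using assms by force
next
  fix w w' j
  assume w: "w \<in> {w \<in> words k n. \<forall>i\<in>I. occurs_at u w i}"
      "w' \<in> {w \<in> words k n. \<forall>i\<in>I. occurs_at u w i}"
    and "j \<in> (\<Union>i\<in>I. {i..<i + length u})"
  then obtain i where "i \<in> I" "i \<le> j" "j < i + length u" by auto
  then show "w ! j = w' ! j"
    using w occurs_at_nth[of u _ i j] by auto
qed auto

lemma card_words_occurs_at:
  assumes "set u \<subseteq> {0..<k}" "i + length u \<le> n"
  shows "k ^ (n - length u) \<le> card {w \<in> words k n. occurs_at u w i}"
proof -
  let ?r = "n - length u - i"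
  have "card (words k i \<times> words k ?r) \<le> card {w \<in> words k n. occurs_at u w i}"
  proof (rule card_inj_on_le)
    show "inj_on (\<lambda>(x, y). x @ u @ y) (words k i \<times> words k ?r)"
      by (auto simp: inj_on_def words_def)
    show "(\<lambda>(x, y). x @ u @ y) ` (words k i \<times> words k ?r) \<subseteq> {w \<in> words k n. occurs_at u w i}"
      using assms by (auto simp: words_def occurs_at_iff_take_drop subset_iff)
  qed simp
  moreover have "card (words k i \<times> words k ?r) = k ^ (n - length u)"
    using assms(2) by (simp add: card_cartesian_product card_words flip: power_add)
  ultimately show ?thesis by simp
qed

lemma card_words_bordered:
  assumes "set u \<subseteq> {0..<k}" "2 * length u \<le> n"
  shows "k ^ (n - 2 * length u)
           \<le> card {w \<in> words k n. occurs_at u w 0 \<and> occurs_at u w (n - length u)}"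
    (is "_ \<le> card ?W")
proof -
  let ?f = "\<lambda>v. u @ v @ u"
  have "card (words k (n - 2 * length u)) \<le> card ?W"
  proof (rule card_inj_on_le)
    show "inj_on ?f (words k (n - 2 * length u))"
      by (auto simp: inj_on_def)
    show "?f ` words k (n - 2 * length u) \<subseteq> ?W"
    proof safe
      fix v assume v: "v \<in> words k (n - 2 * length u)"
      then have "n - length u = length (u @ v)" and "length v = n - 2 * length u"
        using assms(2) by (auto simp: words_def)
      then show "?f v \<in> words k n" "occurs_at u (?f v) 0" "occurs_at u (?f v) (n - length u)"
        using v assms by (auto simp: words_def occurs_at_iff_take_drop)
    qed
  qed simp
  then show ?thesis by (simp add: card_words)
qed

lemma sum_half_powers_le: "(\<Sum>i=m..<n. (1/2::real) ^ i) \<le> 2 * (1/2) ^ m"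
proof (cases "m \<le> n")
  case True
  then have "(\<Sum>i=m..<n. (1/2::real) ^ i) = 2 * (1/2) ^ m - 2 * (1/2) ^ n"
    by (induction n rule: dec_induct) auto
  then show ?thesis by simp
qed simp

lemma power_diff_le_half_power:
  assumes "2 \<le> k" "i \<le> n"
  shows "real (k ^ (n - i)) \<le> real (k ^ n) * (1/2) ^ i"
proof -
  have "(2::real) ^ i \<le> real k ^ i"
    using assms by (intro power_mono) auto
  then have "real k ^ (n - i) * 2 ^ i \<le> real k ^ (n - i) * real k ^ i"
    by (rule mult_left_mono) simp
  also have "\<dots> = real k ^ n"
    using assms by (simp flip: power_add)
  finally show ?thesis
    by (simp add: field_simps)
qed

section \<open>Words closed by a given word: lower bound\<close>

text \<open>Vacuously true when \<open>d\<close> is at least the length, so distant occurrences need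
  no separate treatment in the overlap lemma.\<close>

definition periodic :: "nat \<Rightarrow> 'a list \<Rightarrow> bool" where
  "periodic d u \<longleftrightarrow> (\<forall>j. j + d < length u \<longrightarrow> u ! (j + d) = u ! j)"

lemma overlap_imp_periodic:
  assumes "occurs_at u w i" "occurs_at u w (i + d)"
  shows "periodic d u"
  unfolding periodic_def
proof (intro allI impI)
  fix j assume j: "j + d < length u"
  then have "u ! (j + d) = w ! (i + (j + d))"
    using assms(1) by (auto simp: occurs_at_def)
  also have "\<dots> = w ! (i + d + j)"
    by (simp add: ac_simps)
  also have "\<dots> = u ! j"
    using assms(2) j by (auto simp: occurs_at_def)
  finally show "u ! (j + d) = u ! j" .
qed

text \<open>Among the words with \<open>u\<close> at both ends, those with a third occurrence are
  removed by a union bound over its position \<open>i\<close>; they make up at most 3/4 of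
  \<open>k ^ (n - 2 * t)\<close>.\<close>

lemma card_closed_by_ge:
  assumes k: "2 \<le> k" and u: "set u \<subseteq> {0..<k}"
    and t: "length u = t" "3 \<le> t" "3 * t \<le> n" "4 * n \<le> k ^ t"
    and np: "\<not> periodic 1 u" "\<not> periodic 2 u"
  shows "real (k ^ (n - 2 * t)) / 4 \<le> card {w \<in> words k n. closed_by w u}"
    (is "?K / 4 \<le> card ?C")
proof -
  define s where "s = n - t"
  define bad where "bad = (\<lambda>i. {w \<in> words k n. \<forall>i'\<in>{0, i, s}. occurs_at u w i'})"
  let ?W = "{w \<in> words k n. occurs_at u w 0 \<and> occurs_at u w s}"
  have s: "n = s + t" "2 * t \<le> s"
    using t by (auto simp: s_def)
  \<comment> \<open>A third occurrence within distance 2 of either end copy would give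
    \<open>u\<close> the period 1 or 2.\<close>
  have far: "3 \<le> i \<and> i \<le> s - 3"
    if w: "w \<in> words k n" "occurs_at u w 0" "occurs_at u w s" "occurs_at u w i"
      and i: "i \<noteq> 0" "i \<noteq> s" for w i
  proof -
    have "i + t \<le> n"
      using w t by (auto simp: occurs_at_def words_def)
    then have "i < s" using i s by auto
    moreover have "i \<noteq> 1" "i \<noteq> 2"
      using overlap_imp_periodic[of u w 0 i] w np by auto
    moreover have "s - i \<noteq> 1" "s - i \<noteq> 2"
      using overlap_imp_periodic[of u w i "s - i"] w np \<open>i < s\<close> by auto
    ultimately show ?thesis using i by linarith
  qed
  have "?W \<subseteq> ?C \<union> (\<Union>i\<in>{3..s-3}. bad i)"
  proof
    fix w assume w: "w \<in> ?W"
    then have len: "length w = n" by (simp add: words_def)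
    show "w \<in> ?C \<union> (\<Union>i\<in>{3..s-3}. bad i)"
    proof (cases "\<exists>i. occurs_at u w i \<and> i \<noteq> 0 \<and> i \<noteq> s")
      case True
      then obtain i where "occurs_at u w i" "i \<noteq> 0" "i \<noteq> s" by blast
      then show ?thesis using w far[of w i] by (auto simp: bad_def)
    next
      case False
      have "n - length u = s" "u \<noteq> []" "length u < n"
        using t s by auto
      then have "closed_by w u"
        using False w len by (auto simp: closed_by_iff)
      then show ?thesis using w by simp
    qed
  qed
  then have "card ?W \<le> card (?C \<union> (\<Union>i\<in>{3..s-3}. bad i))"
    by (intro card_mono) (auto simp: bad_def)
  also have "\<dots> \<le> card ?C + card (\<Union>i\<in>{3..s-3}. bad i)"
    by (rule card_Un_le)
  also have "card (\<Union>i\<in>{3..s-3}. bad i) \<le> (\<Sum>i=3..s-3. card (bad i))"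
    by (rule card_UN_le) simp
  finally have "real (card ?W) \<le> card ?C + (\<Sum>i=3..s-3. real (card (bad i)))"
    by (simp flip: of_nat_sum of_nat_add)
  moreover have "?K \<le> card ?W"
    using card_words_bordered[OF u, of n] t(1,3) by (simp add: s_def)
  moreover have bad_le: "real (card (bad i)) \<le> ?K * ((1/2) ^ i + (1/2) ^ (s - i) + 1 / real k ^ t)"
    if i: "i \<in> {3..s-3}" for i
  proof -
    let ?U = "\<Union>i'\<in>{0, i, s}. {i'..<i' + length u}"
    have le: "card (bad i) \<le> k ^ (n - card ?U)"
      unfolding bad_def using i s t by (intro card_words_occurrences_le) auto
    have K: "0 \<le> ?K" by simp
    \<comment> \<open>The third copy overlaps the first one, neither, or the last one, and forces
      \<open>i\<close>, \<open>t\<close> or \<open>s - i\<close> further letters.\<close>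
    consider "i < t" | "t \<le> i" "i + t \<le> s" | "s < i + t" by linarith
    then show ?thesis
    proof cases
      case 1
      then have "?U = {0..<t + i} \<union> {s..<n}"
        using t s by auto
      moreover have "card ({0..<t + i} \<union> {s..<n}) = 2 * t + i"
        using 1 s by (subst card_Un_disjoint) auto
      ultimately have "real (card (bad i)) \<le> real (k ^ (n - 2 * t - i))"
        using le by (simp add: diff_diff_add del: of_nat_power)
      also have "\<dots> \<le> ?K * (1/2) ^ i"
        using 1 s k by (intro power_diff_le_half_power) auto
      also have "\<dots> \<le> ?K * ((1/2) ^ i + (1/2) ^ (s - i) + 1 / real k ^ t)"
        by (intro mult_left_mono) auto
      finally show ?thesis .
    next
      case 2
      then have "?U = ({0..<t} \<union> {i..<i + t}) \<union> {s..<n}"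
        using t s by auto
      moreover have "card (({0..<t} \<union> {i..<i + t}) \<union> {s..<n}) = 3 * t"
        using 2 s by (subst card_Un_disjoint, auto)+
      ultimately have "real (card (bad i)) \<le> real (k ^ (n - 2 * t - t))"
        using le by (simp add: diff_diff_add del: of_nat_power)
      also have "\<dots> = ?K * (1 / real k ^ t)"
        using s k power_diff[of "real k" t "n - 2 * t"] by simp
      also have "\<dots> \<le> ?K * ((1/2) ^ i + (1/2) ^ (s - i) + 1 / real k ^ t)"
        by (intro mult_left_mono) auto
      finally show ?thesis .
    next
      case 3
      then have "?U = {0..<t} \<union> {i..<n}"
        using t s i by auto
      moreover have "card ({0..<t} \<union> {i..<n}) = 2 * t + (s - i)"
        using 3 s i by (subst card_Un_disjoint) auto
      ultimately have "real (card (bad i)) \<le> real (k ^ (n - 2 * t - (s - i)))"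
        using le by (simp add: diff_diff_add del: of_nat_power)
      also have "\<dots> \<le> ?K * (1/2) ^ (s - i)"
        using 3 s k by (intro power_diff_le_half_power) auto
      also have "\<dots> \<le> ?K * ((1/2) ^ i + (1/2) ^ (s - i) + 1 / real k ^ t)"
        by (intro mult_left_mono) auto
      finally show ?thesis .
    qed
  qed
  moreover have "(\<Sum>i=3..s-3. real (card (bad i))) \<le> ?K * (3/4)"
  proof -
    have half: "(\<Sum>i=3..s-3. (1/2::real) ^ i) \<le> 1/4"
      using sum_half_powers_le[of 3 "Suc (s - 3)"]
      by (simp add: atLeastLessThanSuc_atLeastAtMost power3_eq_cube)
    have "(\<Sum>i=3..s-3. (1/2::real) ^ (s - i)) = (\<Sum>i=3..s-3. (1/2) ^ i)"
      using s t by (subst (2) sum.atLeastAtMost_rev) simp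
    moreover have "(\<Sum>i=3..s-3. 1 / real k ^ t) \<le> 1/4"
    proof -
      have "real (4 * n) \<le> real (k ^ t)" using t(4) of_nat_mono by blast
      then have "real n / real k ^ t \<le> 1/4" using k by (simp add: field_simps)
      moreover have "real (Suc (s - 3) - 3) * (1 / real k ^ t) \<le> real n / real k ^ t"
        using s k by (simp add: field_simps)
      ultimately show ?thesis
        by (simp only: sum_constant card_atLeastAtMost)
    qed
    ultimately have "(\<Sum>i=3..s-3. (1/2) ^ i + (1/2) ^ (s - i) + 1 / real k ^ t) \<le> 3/4"
      using half by (simp only: sum.distrib)
    then have "?K * (\<Sum>i=3..s-3. (1/2) ^ i + (1/2) ^ (s - i) + 1 / real k ^ t) \<le> ?K * (3/4)"
      by (intro mult_left_mono) auto
    moreover have "(\<Sum>i=3..s-3. real (card (bad i)))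
        \<le> (\<Sum>i=3..s-3. ?K * ((1/2) ^ i + (1/2) ^ (s - i) + 1 / real k ^ t))"
      by (rule sum_mono) (rule bad_le)
    ultimately show ?thesis
      by (simp only: sum_distrib_left)
  qed
  ultimately show ?thesis by linarith
qed

section \<open>Words closed by a given word: upper bound\<close>

definition avoiding :: "nat \<Rightarrow> nat list \<Rightarrow> nat \<Rightarrow> nat list set" where
  "avoiding k u n = {w \<in> words k n. \<forall>i. \<not> occurs_at u w i}"

lemma finite_avoiding [simp]: "finite (avoiding k u n)"
  by (simp add: avoiding_def)

text \<open>Cutting at position \<open>a\<close> is injective, and both pieces inherit avoidance.
  Occurrences across the cut are ignored, hence only an inequality.\<close>

lemma card_avoiding_add:
  "card (avoiding k u (a + b)) \<le> card (avoiding k u a) * card (avoiding k u b)"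
proof -
  have "card (avoiding k u (a + b)) \<le> card (avoiding k u a \<times> avoiding k u b)"
  proof (rule card_inj_on_le)
    show "inj_on (\<lambda>w. (take a w, drop a w)) (avoiding k u (a + b))"
      by (auto simp: inj_on_def) (metis append_take_drop_id)
    show "(\<lambda>w. (take a w, drop a w)) ` avoiding k u (a + b) \<subseteq> avoiding k u a \<times> avoiding k u b"
    proof safe
      fix w assume w: "w \<in> avoiding k u (a + b)"
      have "\<not> occurs_at u (take a w) i" "\<not> occurs_at u (drop a w) i" for i
        using w occurs_at_append_right[of u "take a w" i "drop a w"]
          occurs_at_append_left[of u "drop a w" i "take a w"]
        by (auto simp: avoiding_def)
      then show "take a w \<in> avoiding k u a" "drop a w \<in> avoiding k u b"
        using w set_take_subset[of a w] set_drop_subset[of a w]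
        by (fastforce simp: avoiding_def words_def)+
    qed
  qed simp
  then show ?thesis by (simp add: card_cartesian_product)
qed

lemma card_avoiding_blocks:
  "card (avoiding k u (q * m + r)) \<le> card (avoiding k u m) ^ q * k ^ r"
proof (induction q)
  case 0
  have "card (avoiding k u r) \<le> card (words k r)"
    by (intro card_mono) (auto simp: avoiding_def)
  then show ?case by (simp add: card_words)
next
  case (Suc q)
  have "card (avoiding k u (Suc q * m + r)) \<le> card (avoiding k u m) * card (avoiding k u (q * m + r))"
    using card_avoiding_add[of k u m "q * m + r"] by (simp add: add.assoc)
  also have "\<dots> \<le> card (avoiding k u m) * (card (avoiding k u m) ^ q * k ^ r)"
    using Suc by (rule mult_le_mono2)
  finally show ?case by (simp add: mult.assoc)
qed

text \<open>At least half of the words with an occurrence at \<open>i < t\<close> have no earlier occurrence: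
  if \<open>u\<close> does not have period 1, earlier overlapping occurrences are shifted by at least 2 and a
  union bound suffices; otherwise \<open>u\<close> is a power of a letter and only the letter preceding the
  occurrence matters.\<close>

lemma card_first_occurrence_ge:
  assumes k: "2 \<le> k" and u: "set u \<subseteq> {0..<k}" and t: "length u = t" "i < t"
  shows "real (k ^ t) / 2
    \<le> card {w \<in> words k (2 * t). occurs_at u w i \<and> (\<forall>i'<i. \<not> occurs_at u w i')}"
    (is "_ \<le> real (card ?E)")
proof -
  let ?O = "{w \<in> words k (2 * t). occurs_at u w i}"
  let ?B = "{w \<in> ?O. \<exists>i'<i. occurs_at u w i'}"
  have "real (k ^ t) \<le> card ?O"
    using card_words_occurs_at[OF u, of i "2 * t"] t by simp
  moreover have "?O = ?E \<union> ?B" by auto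
  then have "card ?O \<le> card ?E + card ?B"
    by (metis (no_types, lifting) card_Un_le)
  moreover have "real (card ?B) \<le> real (k ^ t) / 2"
  proof (cases "periodic 1 u")
    case True
    have const: "u ! j = u ! 0" if "j < t" for j
      using that
    proof (induction j)
      case (Suc j)
      then show ?case using True t by (auto simp: periodic_def)
    qed simp
    show ?thesis
    proof (cases "i = 0")
      case False
      let ?F = "{i - 1..<i + t}"
      have val: "w ! j = u ! 0" if w: "w \<in> ?B" and j: "j \<in> ?F" for w j
      proof (cases "i \<le> j")
        case True
        then show ?thesis
          using occurs_at_nth[of u w i j] w j t const[of "j - i"] by auto
      next
        case False
        obtain i' where i': "i' < i" "occurs_at u w i'" using w by auto
        \<comment> \<open>Here \<open>j = i - 1\<close>, which lies in the window of the earlier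
          occurrence because \<open>i' < i\<close> and \<open>i < t\<close>.\<close>
        then have "w ! j = u ! (j - i')"
          using occurs_at_nth[of u w i' j] False t j by auto
        then show ?thesis
          using const[of "j - i'"] False t by auto
      qed
      have "card ?B \<le> k ^ (2 * t - card ?F)"
      proof (rule card_words_agreeing_le)
        show "w ! j = w' ! j" if "w \<in> ?B" "w' \<in> ?B" "j \<in> ?F" for w w' j
          using val[OF that(1,3)] val[OF that(2,3)] by simp
      qed (use t in auto)
      then have "real (card ?B) \<le> real (k ^ (t - 1))"
        using False t by simp
      also have "\<dots> \<le> real (k ^ t) * (1/2) ^ 1"
        using k t by (intro power_diff_le_half_power) auto
      finally show ?thesis by simp
    qed simp
  next
    case False
    let ?O2 = "\<lambda>d. {w \<in> words k (2 * t). \<forall>i'\<in>{i - d, i}. occurs_at u w i'}"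
    have "?B \<subseteq> (\<Union>d\<in>{2..<Suc i}. ?O2 d)"
    proof
      fix w assume w: "w \<in> ?B"
      then obtain i' where i': "i' < i" "occurs_at u w i'" by auto
      have "i - i' \<noteq> 1"
        using overlap_imp_periodic[of u w i' "i - i'"] i' w False by auto
      then have "i - i' \<in> {2..<Suc i}" "w \<in> ?O2 (i - i')"
        using w i' by auto
      then show "w \<in> (\<Union>d\<in>{2..<Suc i}. ?O2 d)" by blast
    qed
    then have "card ?B \<le> card (\<Union>d\<in>{2..<Suc i}. ?O2 d)"
      by (intro card_mono) auto
    also have "\<dots> \<le> (\<Sum>d=2..<Suc i. card (?O2 d))"
      by (rule card_UN_le) simp
    finally have "real (card ?B) \<le> (\<Sum>d=2..<Suc i. real (card (?O2 d)))"
      by (simp flip: of_nat_sum)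
    also have "\<dots> \<le> (\<Sum>d=2..<Suc i. real (k ^ t) * (1/2) ^ d)"
    proof (rule sum_mono)
      fix d assume d: "d \<in> {2..<Suc i}"
      have "card (?O2 d) \<le> k ^ (2 * t - card (\<Union>i'\<in>{i - d, i}. {i'..<i' + length u}))"
        using t by (intro card_words_occurrences_le) auto
      also have "(\<Union>i'\<in>{i - d, i}. {i'..<i' + length u}) = {i - d..<i + t}"
        using d t by auto
      also have "2 * t - card {i - d..<i + t} = t - d"
        using d t by auto
      finally have "real (card (?O2 d)) \<le> real (k ^ (t - d))"
        using of_nat_mono by blast
      also have "\<dots> \<le> real (k ^ t) * (1/2) ^ d"
        using k t d by (intro power_diff_le_half_power) auto
      finally show "real (card (?O2 d)) \<le> real (k ^ t) * (1/2) ^ d" .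
    qed
    also have "\<dots> \<le> real (k ^ t) * (2 * (1/2) ^ 2)"
      unfolding sum_distrib_left[symmetric]
      by (intro mult_left_mono sum_half_powers_le) simp
    finally show ?thesis by (simp add: power2_eq_square)
  qed
  ultimately show ?thesis by linarith
qed

text \<open>In a block of length \<open>2 * t\<close> an occurrence fits at each of the positions
  below \<open>t\<close>. The events "first occurrence at \<open>i\<close>" are disjoint, so their
  probabilities, each at least \<open>1 / (2 * k ^ t)\<close>, add up.\<close>

lemma card_avoiding_block:
  assumes k: "2 \<le> k" and u: "set u \<subseteq> {0..<k}" and t: "length u = t"
  shows "real (card (avoiding k u (2 * t))) \<le> real (k ^ (2 * t)) * (1 - t / (2 * real (k ^ t)))"
proof -
  let ?E = "\<lambda>i. {w \<in> words k (2 * t). occurs_at u w i \<and> (\<forall>i'<i. \<not> occurs_at u w i')}"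
  have "avoiding k u (2 * t) \<union> (\<Union>i\<in>{..<t}. ?E i) \<subseteq> words k (2 * t)"
    by (auto simp: avoiding_def)
  then have "card (avoiding k u (2 * t) \<union> (\<Union>i\<in>{..<t}. ?E i)) \<le> k ^ (2 * t)"
    unfolding card_words[symmetric] by (intro card_mono) simp_all
  moreover have "card (avoiding k u (2 * t) \<union> (\<Union>i\<in>{..<t}. ?E i))
      = card (avoiding k u (2 * t)) + card (\<Union>i\<in>{..<t}. ?E i)"
    by (rule card_Un_disjoint) (auto simp: avoiding_def)
  moreover have "card (\<Union>i\<in>{..<t}. ?E i) = (\<Sum>i<t. card (?E i))"
  proof (rule card_UN_disjoint)
    show "\<forall>i\<in>{..<t}. \<forall>j\<in>{..<t}. i \<noteq> j \<longrightarrow> ?E i \<inter> ?E j = {}"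
      using nat_neq_iff by blast
  qed auto
  ultimately have "card (avoiding k u (2 * t)) + (\<Sum>i<t. card (?E i)) \<le> k ^ (2 * t)"
    by simp
  then have "real (card (avoiding k u (2 * t))) + (\<Sum>i<t. real (card (?E i))) \<le> real (k ^ (2 * t))"
    using of_nat_mono[where 'a = real] by fastforce
  moreover have "(\<Sum>i<t. real (k ^ t) / 2) \<le> (\<Sum>i<t. real (card (?E i)))"
    using card_first_occurrence_ge[OF k u t] by (intro sum_mono) auto
  ultimately have "real (card (avoiding k u (2 * t))) \<le> real (k ^ (2 * t)) - t * (real (k ^ t) / 2)"
    by simp
  also have "\<dots> = real (k ^ (2 * t)) * (1 - t / (2 * real (k ^ t)))"
    using k by (simp add: field_simps power_mult power2_eq_square flip: power_mult_distrib power_add)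
  finally show ?thesis .
qed

text \<open>The part between the two copies of \<open>u\<close> avoids \<open>u\<close> and
  determines the word. Its \<open>q\<close> full blocks each contribute a factor
  \<open>1 - t / (2 * k ^ t)\<close>, bounded by an exponential.\<close>

lemma card_closed_by_le:
  assumes k: "2 \<le> k" and u: "set u \<subseteq> {0..<k}" and t: "length u = t" "1 \<le> t" "8 * t \<le> n"
  shows "real (card {w \<in> words k n. closed_by w u}) \<le> real (k ^ (n - 2 * t)) * exp (- real n / (8 * real (k ^ t)))"
    (is "real (card ?C) \<le> _")
proof -
  define m where "m = n - 2 * t"
  define q where "q = m div (2 * t)"
  define r where "r = m mod (2 * t)"
  have m: "m = q * (2 * t) + r"
    by (simp only: q_def r_def div_mult_mod_eq)
  have r: "r < 2 * t"
    using t(2) by (simp add: r_def)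
  have split: "w = u @ take m (drop t w) @ u" if "w \<in> ?C" for w
  proof -
    have len: "length w = n" using that by (simp add: words_def)
    have "take t w = u"
      using that closed_by_take t by auto
    moreover have "drop (n - t) w = u"
      using closed_byD(4)[of w u] that len t by (auto simp: occurs_at_iff_take_drop)
    moreover have "w = take t w @ take m (drop t w) @ drop (t + m) w"
      by (metis add.commute append_take_drop_id drop_drop)
    moreover have "t + m = n - t" using t by (simp add: m_def)
    ultimately show ?thesis by metis
  qed
  have "card ?C \<le> card (avoiding k u m)"
  proof (rule card_inj_on_le)
    show "inj_on (\<lambda>w. take m (drop t w)) ?C"
      by (rule inj_onI) (metis split)
    show "(\<lambda>w. take m (drop t w)) ` ?C \<subseteq> avoiding k u m"
    proof
      fix v assume "v \<in> (\<lambda>w. take m (drop t w)) ` ?C"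
      then obtain w where w: "w \<in> ?C" "v = take m (drop t w)" by blast
      have len: "length w = n" using w by (simp add: words_def)
      have "length v = m" "set v \<subseteq> {0..<k}"
        using w len t set_take_subset[of m "drop t w"] set_drop_subset[of t w]
        by (auto simp: m_def words_def)
      moreover have "\<not> occurs_at u v i" for i
      proof
        assume occ: "occurs_at u v i"
        then have "occurs_at u w (t + i)"
          using split[OF w(1)] occurs_at_append_left[OF occurs_at_append_right[OF occ, of u], of u] t w
          by simp
        then have "t + i = 0 \<or> t + i = n - t"
          using w len t by (auto simp: closed_by_iff)
        moreover have "i + t \<le> m"
          using occ \<open>length v = m\<close> t by (auto simp: occurs_at_def)
        ultimately show False using t by (auto simp: m_def)
      qed
      ultimately show "v \<in> avoiding k u m"
        by (simp add: avoiding_def words_def)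
    qed
  qed simp
  also have "\<dots> \<le> card (avoiding k u (2 * t)) ^ q * k ^ r"
    using card_avoiding_blocks[of k u q "2 * t" r] m by simp
  finally have "real (card ?C) \<le> real (card (avoiding k u (2 * t))) ^ q * real k ^ r"
    using of_nat_mono[where 'a = real] by fastforce
  also have "\<dots> \<le> (real (k ^ (2 * t)) * exp (- (t / (2 * real (k ^ t))))) ^ q * real k ^ r"
  proof (intro mult_right_mono power_mono)
    have "real (k ^ (2 * t)) * (1 - t / (2 * real (k ^ t)))
        \<le> real (k ^ (2 * t)) * exp (- (t / (2 * real (k ^ t))))"
      using exp_ge_add_one_self[of "- (t / (2 * real (k ^ t)))"] by (intro mult_left_mono) auto
    then show "real (card (avoiding k u (2 * t))) \<le> real (k ^ (2 * t)) * exp (- (t / (2 * real (k ^ t))))"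
      using card_avoiding_block[OF k u t(1)] by linarith
  qed auto
  also have "\<dots> = real (k ^ m) * exp (- (real q * t / (2 * real (k ^ t))))"
    by (subst m) (simp add: power_mult_distrib power_add mult_ac flip: exp_of_nat_mult power_mult)
  also have "\<dots> \<le> real (k ^ m) * exp (- real n / (8 * real (k ^ t)))"
  proof (intro mult_left_mono)
    \<comment> \<open>Since \<open>2 * q * t = m - r > n - 4 * t\<close> and
      \<open>8 * t \<le> n\<close>, full blocks cover at least half of \<open>n\<close>; this is the
      origin of the 8 in the exponent.\<close>
    have "n \<le> 4 * (q * t)"
      using m r t by (auto simp: m_def)
    then have "real n \<le> 4 * (real q * real t)"
      by (metis of_nat_le_iff of_nat_mult of_nat_numeral)
    then show "exp (- (real q * t / (2 * real (k ^ t)))) \<le> exp (- real n / (8 * real (k ^ t)))"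
      using k by (simp add: field_simps)
  qed simp
  finally show ?thesis by (simp add: m_def)
qed

text \<open>From position \<open>n - t\<close> on, every letter repeats the one \<open>n - t\<close>
  places earlier. The two copies may overlap, so the prefix of length \<open>n - t\<close>
  determines the word by strong induction on the position.\<close>

lemma card_words_with_border_le:
  assumes "1 \<le> t" "t < n"
  shows "card {w \<in> words k n. occurs_at (take t w) w (n - t)} \<le> k ^ (n - t)"
    (is "card ?X \<le> _")
proof -
  have "card ?X \<le> card (words k (n - t))"
  proof (rule card_inj_on_le)
    show "inj_on (take (n - t)) ?X"
    proof (rule inj_onI)
      fix w w' assume X: "w \<in> ?X" "w' \<in> ?X" and eq: "take (n - t) w = take (n - t) w'"
      have len: "length w = n" "length w' = n" using X by (auto simp: words_def)
      have shift: "v ! i = v ! (i - (n - t))" if "v \<in> ?X" "n - t \<le> i" "i < n" for v i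
        using that occurs_at_nth[of "take t v" v "n - t" i] assms by (auto simp: words_def)
      have "w ! i = w' ! i" if "i < n" for i
        using that
      proof (induction i rule: less_induct)
        case (less i)
        show ?case
        proof (cases "i < n - t")
          case True
          then show ?thesis using eq by (metis nth_take)
        next
          case False
          then show ?thesis
            using shift[OF X(1), of i] shift[OF X(2), of i] less assms by auto
        qed
      qed
      then show "w = w'" using len by (auto intro: nth_equalityI)
    qed
    show "take (n - t) ` ?X \<subseteq> words k (n - t)"
      using set_take_subset by (fastforce simp: words_def)
  qed simp
  then show ?thesis by (simp add: card_words)
qed

section \<open>Iterated logarithms\<close>

text \<open>Truncating the logarithm from below at 1 makes all iterates total, monotone and at least 1;
  it agrees with the iterated logarithm for large arguments.\<close>

definition tlog :: "nat \<Rightarrow> real \<Rightarrow> real" where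
  "tlog k x = max 1 (log (real k) x)"

text \<open>The product of the iterates 0 to \<open>j - 1\<close> of \<open>tlog\<close>, times the
  \<open>j\<close>-th iterate to the power \<open>m\<close>. The values \<open>m = 2\<close> and
  \<open>m = 0\<close> serve parts (a) and (b). The recursion replaces \<open>x\<close> by
  \<open>tlog k x\<close>, as the counting passes from \<open>n\<close> to a border length.\<close>

fun itprod :: "nat \<Rightarrow> nat \<Rightarrow> nat \<Rightarrow> real \<Rightarrow> real" where
  "itprod k m 0 x = x ^ m"
| "itprod k m (Suc j) x = x * itprod k m j (tlog k x)"

lemma tlog_ge_1: "1 \<le> tlog k x"
  by (simp add: tlog_def)

lemma tlog_mono: "2 \<le> k \<Longrightarrow> 1 \<le> x \<Longrightarrow> x \<le> y \<Longrightarrow> tlog k x \<le> tlog k y"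
  unfolding tlog_def by (intro max.mono) auto

lemma log_of_nat_le:
  assumes "2 \<le> k" "1 \<le> a"
  shows "log (real k) (real a) \<le> real a - 1"
proof -
  obtain b where b: "a = Suc b"
    using assms by (cases a) auto
  have "Suc b \<le> k ^ b"
    using less_exp[of b] power_mono[OF assms(1), of b] by linarith
  then have "real a \<le> real k ^ b"
    using b by (metis of_nat_le_iff of_nat_power)
  then have "log k (real a) \<le> log k (real k ^ b)"
    using assms by (subst log_le_cancel_iff) auto
  then show ?thesis
    using assms b by (simp add: log_nat_power)
qed

text \<open>The summand \<open>log a\<close>, at most \<open>a - 1\<close>, is absorbed into a
  factor because \<open>tlog\<close> is at least 1. Constant factors thus survive every further
  logarithm unchanged.\<close>

lemma tlog_scale_le:
  assumes "2 \<le> k" "1 \<le> a" "1 \<le> x"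
  shows "tlog k (real a * x) \<le> real a * tlog k x"
proof -
  have "log k (real a * x) = log k (real a) + log k x"
    using assms by (simp add: log_mult)
  also have "\<dots> \<le> (real a - 1) * 1 + tlog k x"
    using log_of_nat_le[OF assms(1,2)] by (simp add: tlog_def)
  also have "\<dots> \<le> (real a - 1) * tlog k x + tlog k x"
    using assms tlog_ge_1 by (intro add_right_mono mult_left_mono) auto
  finally have "log k (real a * x) \<le> real a * tlog k x"
    by (simp add: algebra_simps)
  moreover have "1 * 1 \<le> real a * tlog k x"
    using assms tlog_ge_1 by (intro mult_mono) auto
  ultimately show ?thesis
    by (simp add: tlog_def)
qed

lemma itprod_ge_1: "1 \<le> x \<Longrightarrow> 1 \<le> itprod k m j x"
proof (induction j arbitrary: x)
  case (Suc j)
  then have "1 * 1 \<le> x * itprod k m j (tlog k x)"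
    using tlog_ge_1 by (intro mult_mono) auto
  then show ?case by simp
qed simp

lemma itprod_pos: "1 \<le> x \<Longrightarrow> 0 < itprod k m j x"
  using itprod_ge_1[of x k m j] by linarith

lemma itprod_mono:
  assumes "2 \<le> k"
  shows "1 \<le> x \<Longrightarrow> x \<le> y \<Longrightarrow> itprod k m j x \<le> itprod k m j y"
proof (induction j arbitrary: x y)
  case 0
  then show ?case by (simp add: power_mono)
next
  case (Suc j)
  then have "x * itprod k m j (tlog k x) \<le> y * itprod k m j (tlog k y)"
    using assms itprod_pos[OF tlog_ge_1, of k m j k x]
    by (intro mult_mono Suc.IH tlog_ge_1 tlog_mono) auto
  then show ?case by simp
qed

text \<open>Each of the \<open>j\<close> single factors and of the \<open>m\<close> copies of the
  last one grows at most by the factor \<open>a\<close>, so border lengths matter only up to a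
  constant multiple.\<close>

lemma itprod_scale_le:
  assumes "2 \<le> k" "1 \<le> a"
  shows "1 \<le> x \<Longrightarrow> itprod k m j (real a * x) \<le> real a ^ (j + m) * itprod k m j x"
proof (induction j arbitrary: x)
  case 0
  then show ?case by (simp add: power_mult_distrib)
next
  case (Suc j)
  have "itprod k m j (tlog k (real a * x)) \<le> itprod k m j (real a * tlog k x)"
    using assms Suc.prems by (intro itprod_mono tlog_ge_1 tlog_scale_le)
  also have "\<dots> \<le> real a ^ (j + m) * itprod k m j (tlog k x)"
    by (rule Suc.IH) (rule tlog_ge_1)
  finally have "real a * x * itprod k m j (tlog k (real a * x))
      \<le> real a * x * (real a ^ (j + m) * itprod k m j (tlog k x))"
    using Suc.prems by (intro mult_left_mono) auto
  then show ?case by (simp add: mult_ac)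
qed

lemma itprod_of_nat_le:
  assumes "2 \<le> k" "1 \<le> n"
  shows "itprod k m j (real n) \<le> real n ^ (j + m)"
proof -
  have "tlog k 1 = 1" by (simp add: tlog_def)
  then have "itprod k m j 1 = 1" by (induction j) auto
  then show ?thesis
    using itprod_scale_le[OF assms, of 1 m j] by simp
qed

text \<open>Uses \<open>T \<le> (1 + (T - t)) * t\<close>. Moving from \<open>t\<close> to
  \<open>T\<close> costs a polynomial in the truncated difference, which the geometric decay around
  \<open>T\<close> will outweigh.\<close>

lemma itprod_shift_le:
  assumes "2 \<le> k" "1 \<le> t" "1 \<le> T"
  shows "itprod k m j (real T) \<le> (1 + real (T - t)) ^ (j + m) * itprod k m j (real t)"
proof -
  have "T \<le> t + (T - t)" by simp
  also have "\<dots> \<le> t + (T - t) * t" using assms by (intro add_left_mono) simp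
  finally have "T \<le> (1 + (T - t)) * t" by (simp add: algebra_simps)
  then have "real T \<le> real (1 + (T - t)) * real t"
    by (metis of_nat_le_iff of_nat_mult)
  then have "itprod k m j (real T) \<le> itprod k m j (real (1 + (T - t)) * real t)"
    using assms by (intro itprod_mono) auto
  also have "\<dots> \<le> real (1 + (T - t)) ^ (j + m) * itprod k m j (real t)"
    using assms by (intro itprod_scale_le) auto
  finally show ?thesis by simp
qed

lemma itprod_eq_prod:
  "itprod k m j x = (\<Prod>i<j. (tlog k ^^ i) x) * ((tlog k ^^ j) x) ^ m"
proof (induction j arbitrary: x)
  case (Suc j)
  then show ?case
    by (simp add: prod.lessThan_Suc_shift funpow_swap1 del: prod.lessThan_Suc)
qed simp

lemma iterlog_Suc: "iterlog k (Suc j) x = log (real k) (iterlog k j x)"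
  by (simp add: iterlog_def)

lemma filterlim_iterlog:
  assumes "2 \<le> k"
  shows "filterlim (iterlog k j) at_top at_top"
proof (induction j)
  case 0
  then show ?case by (simp add: iterlog_def filterlim_ident)
next
  case (Suc j)
  have "filterlim (\<lambda>x. ln x / ln (real k)) at_top at_top"
    using assms by real_asymp
  then show ?case
    unfolding iterlog_Suc log_def by (rule filterlim_compose) (rule Suc)
qed

lemma eventually_tlog_eq_iterlog:
  assumes "2 \<le> k"
  shows "\<forall>\<^sub>F x in at_top. \<forall>i\<le>j. (tlog k ^^ i) x = iterlog k i x \<and> 0 < iterlog k i x"
proof (induction j)
  case 0
  then show ?case by (auto simp: iterlog_def)
next
  case (Suc j)
  have "\<forall>\<^sub>F x in at_top. 1 \<le> iterlog k (Suc j) x"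
    using filterlim_iterlog[OF assms, of "Suc j"] by (simp add: filterlim_at_top)
  with Suc show ?case
    by eventually_elim (auto simp: le_Suc_eq iterlog_Suc tlog_def)
qed

lemma eventually_itprod_eq:
  assumes "2 \<le> k"
  shows "\<forall>\<^sub>F n in sequentially.
      itprod k 2 j (real n) = real n * iterlog k j (real n) * (\<Prod>i=1..j. iterlog k i (real n)) \<and>
      itprod k 0 (Suc j) (real n) = real n * (\<Prod>i=1..j. iterlog k i (real n))"
proof -
  have "\<forall>\<^sub>F n in sequentially. \<forall>i\<le>j. (tlog k ^^ i) (real n) = iterlog k i (real n) \<and>
      0 < iterlog k i (real n)"
    using eventually_compose_filterlim[OF eventually_tlog_eq_iterlog[OF assms] filterlim_real_sequentially]
    by simp
  then show ?thesis
  proof eventually_elim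
    case (elim n)
    have "(\<Prod>i<Suc j. (tlog k ^^ i) (real n)) = (\<Prod>i<Suc j. iterlog k i (real n))"
      using elim by (intro prod.cong) auto
    also have "\<dots> = real n * (\<Prod>i=1..j. iterlog k i (real n))"
      by (subst prod.lessThan_Suc_shift)
        (simp add: iterlog_def prod.atLeast1_atMost_eq del: funpow.simps(2))
    finally have eq: "(\<Prod>i<Suc j. (tlog k ^^ i) (real n)) = real n * (\<Prod>i=1..j. iterlog k i (real n))" .
    have "itprod k 2 j (real n) = (\<Prod>i<Suc j. (tlog k ^^ i) (real n)) * (tlog k ^^ j) (real n)"
      by (simp add: itprod_eq_prod power2_eq_square)
    then show ?case
      using eq elim by (simp add: itprod_eq_prod[of k 0 "Suc j"] del: prod.lessThan_Suc itprod.simps)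
  qed
qed

section \<open>Lower bound\<close>

definition aperiodic_privileged :: "nat \<Rightarrow> nat \<Rightarrow> nat list set" where
  "aperiodic_privileged k n =
     {w \<in> words k n. privileged w \<and> \<not> periodic 1 w \<and> \<not> periodic 2 w}"

text \<open>Used contrapositively: a word closed by \<open>u\<close> inherits the absence of a
  period from \<open>u\<close>, which keeps the lower-bound recursion inside
  \<open>aperiodic_privileged\<close>.\<close>

lemma periodic_prefix:
  assumes "periodic d w" "occurs_at u w 0"
  shows "periodic d u"
  unfolding periodic_def
proof (intro allI impI)
  fix j assume j: "j + d < length u"
  then have "w ! (j + d) = u ! (j + d)" "w ! j = u ! j"
    using occurs_at_nth[OF assms(2), of "j + d"] occurs_at_nth[OF assms(2), of j] by auto
  moreover have "j + d < length w"
    using j assms(2) by (simp add: occurs_at_def)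
  then have "w ! (j + d) = w ! j"
    using assms(1) unfolding periodic_def by blast
  ultimately show "u ! (j + d) = u ! j" by simp
qed

lemma finite_aperiodic_privileged [simp]: "finite (aperiodic_privileged k n)"
  by (simp add: aperiodic_privileged_def)

lemma card_aperiodic_privileged_le: "card (aperiodic_privileged k n) \<le> P k n"
  unfolding P_def aperiodic_privileged_def by (intro card_mono) auto

text \<open>The prefix of length \<open>t\<close> of a closed word recovers its border, so different
  borders of length \<open>t\<close> give disjoint sets and their sizes add up.\<close>

lemma aperiodic_privileged_step:
  assumes k: "2 \<le> k" and t: "3 \<le> t" "3 * t \<le> n" "4 * n \<le> k ^ t"
  shows "real (card (aperiodic_privileged k t)) * (real (k ^ (n - 2 * t)) / 4)
           \<le> card (aperiodic_privileged k n)"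
proof -
  let ?C = "\<lambda>u. {w \<in> words k n. closed_by w u}"
  let ?U = "\<Union>u\<in>aperiodic_privileged k t. ?C u"
  have "real (card (aperiodic_privileged k t)) * (real (k ^ (n - 2 * t)) / 4)
      = (\<Sum>u\<in>aperiodic_privileged k t. real (k ^ (n - 2 * t)) / 4)"
    by simp
  also have "\<dots> \<le> (\<Sum>u\<in>aperiodic_privileged k t. real (card (?C u)))"
    using k t by (intro sum_mono card_closed_by_ge) (auto simp: aperiodic_privileged_def words_def)
  also have "\<dots> = card ?U"
  proof -
    have "?C u \<inter> ?C v = {}"
      if "u \<in> aperiodic_privileged k t" "v \<in> aperiodic_privileged k t" "u \<noteq> v" for u v
    proof -
      have "length u = t" "length v = t"
        using that by (auto simp: aperiodic_privileged_def words_def)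
      then show ?thesis
        using \<open>u \<noteq> v\<close> by (metis (no_types, lifting) closed_by_take disjoint_iff mem_Collect_eq)
    qed
    then have "card ?U = (\<Sum>u\<in>aperiodic_privileged k t. card (?C u))"
      by (intro card_UN_disjoint) auto
    then show ?thesis by simp
  qed
  also have "\<dots> \<le> card (aperiodic_privileged k n)"
  proof -
    have "?U \<subseteq> aperiodic_privileged k n"
      by (auto simp: aperiodic_privileged_def intro: privileged.closed
          dest: periodic_prefix[OF _ closed_byD(3)])
    then show ?thesis by (simp add: card_mono)
  qed
  finally show ?thesis .
qed

lemma aperiodic_privileged_nonempty:
  assumes "2 \<le> k" "5 \<le> t"
  shows "1 \<le> card (aperiodic_privileged k t)"
proof -
  \<comment> \<open>This word is closed by 00, which is closed by 0. As \<open>t \<ge> 5\<close>, it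
    begins with 001, which excludes both periods.\<close>
  define w where "w = [0, 0] @ replicate (t - 4) (1::nat) @ [0, 0]"
  have len: "length w = t" using assms by (simp add: w_def)
  have "w ! i = (if i < 2 \<or> t - 2 \<le> i then 0 else 1)" if "i < t" for i
    using that assms unfolding w_def
    by (auto simp: nth_append nth_Cons less_Suc_eq numeral_eq_Suc split: nat.splits)
  then have nth: "w ! 0 = 0" "w ! 1 = 0" "w ! 2 = 1"
    and inner_pos: "\<And>i. i + 2 \<le> t \<Longrightarrow> w ! i = 0 \<Longrightarrow> w ! (i + 1) = 0 \<Longrightarrow> i = 0 \<or> i = t - 2"
    and nth': "w ! (t - 2) = 0" "w ! (t - 1) = 0"
    using assms by (auto split: if_splits)
  have inner: "i = 0 \<or> i = t - 2" if "occurs_at [0, 0] w i" for i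
  proof (rule inner_pos)
    show "i + 2 \<le> t" using that len by (simp add: occurs_at_def)
    show "w ! i = 0" "w ! (i + 1) = 0"
      using occurs_at_nth[OF that, of i] occurs_at_nth[OF that, of "i + 1"] by auto
  qed
  have "privileged [0]" by (rule privileged.short) simp
  moreover have "closed_by [0, 0] [0]"
    by (auto simp: closed_by_iff occurs_at_def)
  ultimately have "privileged [0, 0]" by (rule privileged.closed)
  moreover have "occurs_at [0, 0] w 0" "occurs_at [0, 0] w (t - 2)"
    using nth nth' len assms by (auto simp: occurs_at_def less_Suc_eq numeral_eq_Suc)
  then have "closed_by w [0, 0]"
    using inner len assms by (auto simp: closed_by_iff numeral_eq_Suc)
  ultimately have "privileged w" by (rule privileged.closed)
  moreover have "\<not> periodic 1 w"
    using nth(2,3) len assms(2) unfolding periodic_def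
    by (intro notI) (drule spec[of _ 1], simp add: numeral_2_eq_2)
  moreover have "\<not> periodic 2 w"
    using nth(1,3) len assms(2) unfolding periodic_def
    by (intro notI) (drule spec[of _ 0], simp add: numeral_2_eq_2)
  moreover have "set w \<subseteq> {0..<k}"
    using assms(1) by (auto simp: w_def)
  ultimately have "w \<in> aperiodic_privileged k t"
    using len by (simp add: aperiodic_privileged_def words_def)
  then have "0 < card (aperiodic_privileged k t)"
    unfolding card_gt_0_iff by auto
  then show ?thesis by simp
qed

text \<open>The least \<open>t\<close> with \<open>4 * n \<le> k ^ t\<close> works: minimality
  bounds \<open>k ^ t\<close> from above. The threshold \<open>k ^ 9\<close> makes \<open>t\<close>
  large enough for \<open>12 * t \<le> 2 ^ (t - 1)\<close>, whence
  \<open>3 * t \<le> n\<close>.\<close>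

lemma border_length_exists:
  assumes k: "2 \<le> k" and n: "k ^ 9 \<le> n"
  obtains t where "9 \<le> t" "3 * t \<le> n" "4 * n \<le> k ^ t" "k ^ t \<le> 4 * k * n"
proof -
  define t where "t = (LEAST t. 4 * n \<le> k ^ t)"
  have "4 * n \<le> 2 ^ (4 * n)" by (meson less_exp less_imp_le)
  also have "(2::nat) ^ (4 * n) \<le> k ^ (4 * n)" using k by (rule power_mono) simp
  finally have ge: "4 * n \<le> k ^ t" unfolding t_def by (rule LeastI)
  have "0 < k ^ 9" using k by simp
  then have n0: "0 < n" using n by linarith
  have "k ^ 9 < k ^ t" using ge n n0 by linarith
  then have t9: "9 < t" using k by simp
  have lt: "k ^ (t - 1) < 4 * n"
    using not_less_Least[of "t - 1" "\<lambda>t. 4 * n \<le> k ^ t"] t9 by (simp add: t_def not_le)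
  have "k ^ t = k * k ^ (t - 1)" using t9 by (cases t) auto
  then have "k ^ t \<le> 4 * k * n" using lt by simp
  moreover have "3 * t \<le> n"
  proof -
    have "12 * Suc s \<le> 2 ^ s" if "9 \<le> s" for s :: nat
      using that by (induction s rule: dec_induct) auto
    from this[of "t - 1"] have "12 * t \<le> 2 ^ (t - 1)" using t9 by simp
    also have "\<dots> \<le> k ^ (t - 1)" using k by (rule power_mono) simp
    finally show ?thesis using lt by linarith
  qed
  ultimately show ?thesis using ge t9 by (intro that) auto
qed

text \<open>One factor \<open>k ^ t\<close> of \<open>k ^ (2 * t)\<close> is replaced by its bound
  \<open>4 * k * n\<close>; the other one normalises the count of borders to a density.\<close>

lemma aperiodic_privileged_step':
  assumes k: "2 \<le> k" and t: "9 \<le> t" "3 * t \<le> n" "4 * n \<le> k ^ t" "k ^ t \<le> 4 * k * n"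
  shows "real (card (aperiodic_privileged k t)) / real k ^ t * (real k ^ n / (16 * real k * real n))
           \<le> card (aperiodic_privileged k n)"
proof -
  let ?q = "real (card (aperiodic_privileged k t))"
  have pos: "0 < real k ^ t" "0 < real n" "0 < real k" using k t by auto
  have le: "real k ^ t \<le> 4 * real k * real n"
    using t(4) by (metis of_nat_le_iff of_nat_mult of_nat_numeral of_nat_power)
  have "?q / real k ^ t * (real k ^ n / (16 * real k * real n)) = ?q / real k ^ t * (real k ^ n / (4 * (4 * real k * real n)))"
    by simp
  also have "\<dots> \<le> ?q / real k ^ t * (real k ^ n / (4 * real k ^ t))"
    using pos le by (intro mult_left_mono divide_left_mono mult_pos_pos) auto
  also have "\<dots> = ?q * (real (k ^ (n - 2 * t)) / 4)"
    using pos t(2) power_diff[of "real k" "2 * t" n] by (simp add: mult_2 power_add)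
  also have "\<dots> \<le> card (aperiodic_privileged k n)"
    using k t by (intro aperiodic_privileged_step) auto
  finally show ?thesis .
qed

lemma aperiodic_privileged_lower_bound:
  assumes k: "2 \<le> k"
  shows "\<exists>c>0. \<exists>N. \<forall>n\<ge>N. c * real k ^ n / itprod k 2 j (real n) \<le> card (aperiodic_privileged k n)"
proof (induction j)
  case 0
  show ?case
  proof (intro exI conjI allI impI)
    show "0 < 1 / (64 * real k ^ 2)" using k by simp
    fix n assume n: "k ^ 9 \<le> n"
    obtain t where t: "9 \<le> t" "3 * t \<le> n" "4 * n \<le> k ^ t" "k ^ t \<le> 4 * k * n"
      using border_length_exists[OF k n] .
    have pos: "0 < real k ^ t" "0 < real n" "0 < real k" using k t by auto
    have le: "real k ^ t \<le> 4 * real k * real n"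
      using t(4) by (metis of_nat_le_iff of_nat_mult of_nat_numeral of_nat_power)
    have "1 / (64 * real k ^ 2) * real k ^ n / itprod k 2 0 (real n)
        = 1 / (4 * real k * real n) * (real k ^ n / (16 * real k * real n))"
      by (simp add: power2_eq_square)
    also have "\<dots> \<le> real (card (aperiodic_privileged k t)) / real k ^ t * (real k ^ n / (16 * real k * real n))"
      using aperiodic_privileged_nonempty[OF k, of t] t(1) pos le
      by (intro mult_right_mono frac_le) auto
    also have "\<dots> \<le> card (aperiodic_privileged k n)"
      using k t by (rule aperiodic_privileged_step')
    finally show "1 / (64 * real k ^ 2) * real k ^ n / itprod k 2 0 (real n)
        \<le> card (aperiodic_privileged k n)" .
  qed
next
  case (Suc j)
  then obtain c N where c: "0 < c"
    and N: "\<And>n. N \<le> n \<Longrightarrow> c * real k ^ n / itprod k 2 j (real n) \<le> card (aperiodic_privileged k n)"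
    by blast
  let ?H = "itprod k 2 j"
  show ?case
  proof (intro exI conjI allI impI)
    show "0 < c / (16 * real k * 4 ^ (j + 2))" using k c by simp
    \<comment> \<open>The part \<open>k ^ N\<close> forces \<open>t \<ge> N\<close>, so that the
      induction hypothesis applies to the border length.\<close>
    fix n assume n: "k ^ (9 + N) \<le> n"
    have "k ^ 9 \<le> k ^ (9 + N)" "k ^ N \<le> k ^ (9 + N)" using k by (auto intro!: power_increasing)
    then have n9: "k ^ 9 \<le> n" and nN: "k ^ N \<le> n" using n by linarith+
    obtain t where t: "9 \<le> t" "3 * t \<le> n" "4 * n \<le> k ^ t" "k ^ t \<le> 4 * k * n"
      using border_length_exists[OF k n9] .
    have pos: "0 < real k ^ t" "0 < real n" "0 < real k" using k t by auto
    have "k ^ N \<le> k ^ t" using nN t by linarith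
    then have "N \<le> t" using k by simp
    have t_le: "real t \<le> real 4 * tlog k n"
    proof -
      have "real k ^ t \<le> 4 * real k * real n"
        using t(4) by (metis of_nat_le_iff of_nat_mult of_nat_numeral of_nat_power)
      \<comment> \<open>From \<open>4 * k \<le> k ^ 3\<close> follows
        \<open>t \<le> 3 + log n\<close>, and \<open>tlog \<ge> 1\<close> turns this into the factor
        4.\<close>
      also have "\<dots> \<le> real k ^ 2 * real k * real n"
        using k power_mono[of 2 "real k" 2] by (intro mult_right_mono) auto
      also have "\<dots> = real k ^ 3 * real n" by (simp add: power3_eq_cube power2_eq_square)
      finally have "log k (real k ^ t) \<le> log k (real k ^ 3 * real n)"
        using k pos by (subst log_le_cancel_iff) auto
      then have "real t \<le> 3 + log k n"
        using k pos by (simp add: log_mult log_nat_power)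
      then show ?thesis
        using tlog_ge_1[of k n] by (simp add: tlog_def)
    qed
    have "?H t \<le> ?H (real 4 * tlog k n)"
      using k t t_le by (intro itprod_mono) auto
    also have "\<dots> \<le> real 4 ^ (j + 2) * ?H (tlog k n)"
      using k tlog_ge_1 by (intro itprod_scale_le) auto
    finally have H: "?H t \<le> 4 ^ (j + 2) * ?H (tlog k n)" by simp
    have Hpos: "0 < ?H t" "0 < ?H (tlog k n)"
      using t tlog_ge_1 by (auto intro!: itprod_pos)
    have "c / (16 * real k * 4 ^ (j + 2)) * real k ^ n / itprod k 2 (Suc j) (real n)
        = c / (4 ^ (j + 2) * ?H (tlog k n)) * (real k ^ n / (16 * real k * real n))"
      by (simp add: mult_ac)
    also have "\<dots> \<le> c / ?H t * (real k ^ n / (16 * real k * real n))"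
      using H Hpos c by (intro mult_right_mono divide_left_mono mult_pos_pos) auto
    also have "\<dots> = c * real k ^ t / ?H t / real k ^ t * (real k ^ n / (16 * real k * real n))"
      using pos by simp
    also have "\<dots> \<le> real (card (aperiodic_privileged k t)) / real k ^ t * (real k ^ n / (16 * real k * real n))"
      using N[OF \<open>N \<le> t\<close>] by (intro mult_right_mono divide_right_mono) auto
    also have "\<dots> \<le> card (aperiodic_privileged k n)"
      using k t by (rule aperiodic_privileged_step')
    finally show "c / (16 * real k * 4 ^ (j + 2)) * real k ^ n / itprod k 2 (Suc j) (real n)
        \<le> card (aperiodic_privileged k n)" .
  qed
qed

section \<open>Upper bound\<close>

lemma P_le_sum_borders:
  assumes "2 \<le> n"
  shows "P k n \<le> (\<Sum>t=1..<n. card {w \<in> words k n. privileged (take t w) \<and> closed_by w (take t w)})"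
    (is "_ \<le> (\<Sum>t=1..<n. card (?C t))")
proof -
  have "{w \<in> words k n. privileged w} \<subseteq> (\<Union>t\<in>{1..<n}. ?C t)"
  proof
    fix w assume w: "w \<in> {w \<in> words k n. privileged w}"
    then have len: "length w = n" and "privileged w" by (auto simp: words_def)
    from \<open>privileged w\<close> show "w \<in> (\<Union>t\<in>{1..<n}. ?C t)"
    proof cases
      case short
      then show ?thesis using len assms by simp
    next
      case (closed u)
      then have "length u \<in> {1..<n}"
        using closed_byD(1,2)[of w u] len by (auto simp: Suc_le_eq)
      moreover have "w \<in> ?C (length u)"
        using closed w closed_by_take[of w u] by simp
      ultimately show ?thesis by blast
    qed
  qed
  then have "P k n \<le> card (\<Union>t\<in>{1..<n}. ?C t)"
    unfolding P_def by (intro card_mono) auto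
  also have "\<dots> \<le> (\<Sum>t=1..<n. card (?C t))"
    by (rule card_UN_le) simp
  finally show ?thesis .
qed

lemma card_closed_by_privileged_le:
  assumes k: "2 \<le> k" and t: "1 \<le> t" "8 * t \<le> n"
  shows "real (card {w \<in> words k n. privileged (take t w) \<and> closed_by w (take t w)})
    \<le> real (P k t) * (real (k ^ (n - 2 * t)) * exp (- real n / (8 * real (k ^ t))))"
    (is "real (card ?C) \<le> _ * ?e")
proof -
  let ?A = "{u \<in> words k t. privileged u}"
  have "?C \<subseteq> (\<Union>u\<in>?A. {w \<in> words k n. closed_by w u})"
  proof
    fix w assume w: "w \<in> ?C"
    then have "take t w \<in> ?A"
      using t set_take_subset[of t w] by (auto simp: words_def)
    then show "w \<in> (\<Union>u\<in>?A. {w \<in> words k n. closed_by w u})"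
      using w by blast
  qed
  then have "card ?C \<le> card (\<Union>u\<in>?A. {w \<in> words k n. closed_by w u})"
    by (intro card_mono) auto
  also have "\<dots> \<le> (\<Sum>u\<in>?A. card {w \<in> words k n. closed_by w u})"
    by (rule card_UN_le) simp
  finally have "real (card ?C) \<le> (\<Sum>u\<in>?A. real (card {w \<in> words k n. closed_by w u}))"
    by (simp flip: of_nat_sum)
  also have "\<dots> \<le> (\<Sum>u\<in>?A. ?e)"
    using k t by (intro sum_mono card_closed_by_le) (auto simp: words_def)
  finally show ?thesis by (simp add: P_def)
qed

text \<open>The function \<open>y exp (- y / 8)\<close> with \<open>y = n / k\<^sup>t\<close> is at most \<open>y\<close> and at most \<open>128 / y\<close>,
  so it decays geometrically in both directions away from \<open>t = log\<^sub>k n\<close>.\<close>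

lemma exp_decay_le:
  assumes k: "2 \<le> k" and T: "k ^ T \<le> n" "n < k ^ Suc T"
  shows "exp (- real n / (8 * real (k ^ t))) / real k ^ t
           \<le> 128 * real k / real n * (1/2) ^ ((t - T) + (T - t))"
proof -
  have kT: "real k ^ T \<le> real n" "real n \<le> real k * real k ^ T"
    using T of_nat_mono[of "k ^ T" n, where 'a = real]
      of_nat_mono[of n "k ^ Suc T", where 'a = real] by auto
  have "0 < k ^ T" using k by simp
  then have "0 < n" using T(1) by linarith
  then have pos: "0 < real n" "0 < real k" "\<And>i. 0 < real k ^ i"
    using k by auto
  show ?thesis
  proof (cases "T \<le> t")
    case True
    have "exp (- real n / (8 * real (k ^ t))) / real k ^ t \<le> 1 / real k ^ t"
      using pos by (intro divide_right_mono) auto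
    also have "\<dots> = 1 / real k ^ T * (1 / real k ^ (t - T))"
      using True pos by (simp flip: power_add)
    also have "\<dots> \<le> real k / real n * (1/2) ^ (t - T)"
    proof (intro mult_mono)
      show "1 / real k ^ T \<le> real k / real n" using kT pos by (simp add: field_simps)
      show "1 / real k ^ (t - T) \<le> (1/2) ^ (t - T)"
        using k power_mono[of 2 "real k" "t - T"] pos by (simp add: power_divide frac_le)
    qed (use pos in auto)
    also have "\<dots> \<le> 128 * real k / real n * (1/2) ^ (t - T)"
      using pos by (intro mult_right_mono divide_right_mono) auto
    finally show ?thesis using True by simp
  next
    case False
    define y where "y = real n / real k ^ t"
    have "2 ^ (T - t) \<le> real k ^ (T - t)"
      using k by (intro power_mono) auto
    also have "real k ^ (T - t) = real k ^ T / real k ^ t"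
      using False k by (simp add: power_diff)
    also have "\<dots> \<le> y"
      unfolding y_def using kT pos by (intro divide_right_mono) auto
    finally have y: "2 ^ (T - t) \<le> y" .
    then have y0: "0 < y" by (meson less_le_trans zero_less_numeral zero_less_power)
    \<comment> \<open>The quadratic Taylor term of the exponential at \<open>y / 8\<close>.\<close>
    have "y\<^sup>2 / 128 \<le> exp (y / 8)"
      using exp_lower_Taylor_quadratic[of "y / 8"] y0 by (simp add: power_divide)
    then have "exp (- (y / 8)) \<le> 128 / y\<^sup>2"
      using y0 by (simp add: exp_minus field_simps)
    then have "exp (- (y / 8)) / real k ^ t \<le> 128 / y\<^sup>2 / real k ^ t"
      using pos by (intro divide_right_mono) auto
    also have "\<dots> = 128 / real n * (1 / y)"
      using pos by (simp add: y_def power2_eq_square field_simps)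
    also have "\<dots> \<le> 128 * real k / real n * (1/2) ^ (T - t)"
    proof (intro mult_mono)
      show "128 / real n \<le> 128 * real k / real n"
        using k pos by (intro divide_right_mono) auto
      show "1 / y \<le> (1/2) ^ (T - t)"
        using y y0 by (simp add: power_divide frac_le)
    qed (use pos y0 in auto)
    finally show ?thesis
      using False by (simp add: y_def mult.commute)
  qed
qed

lemma summable_poly_half: "summable (\<lambda>d. (1 + real d) ^ j * (1/2) ^ d)"
proof (rule summable_comparison_test_ev)
  have "(\<lambda>d. (1 + real d) ^ j * (1/2) ^ d * real d ^ 2) \<longlonglongrightarrow> 0"
    by real_asymp
  then have "\<forall>\<^sub>F d in sequentially. (1 + real d) ^ j * (1/2) ^ d * real d ^ 2 < 1"
    by (rule order_tendstoD) simp
  with eventually_gt_at_top[of 0]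
  show "\<forall>\<^sub>F d in sequentially. norm ((1 + real d) ^ j * (1/2) ^ d) \<le> inverse (real d ^ 2)"
    by eventually_elim (simp add: field_simps)
  show "summable (\<lambda>d. inverse (real d ^ 2))"
    by (rule inverse_power_summable) simp
qed

text \<open>With truncated subtraction \<open>(t - T) + (T - t)\<close> is the distance of
  \<open>t\<close> and \<open>T\<close>; each distance occurs at most twice.\<close>

lemma sum_distance_le:
  fixes f :: "nat \<Rightarrow> real"
  assumes "summable f" "\<And>d. 0 \<le> f d" "finite A"
  shows "(\<Sum>t\<in>A. f ((t - T) + (T - t))) \<le> 2 * suminf f"
proof -
  have "(\<Sum>t\<in>A \<inter> {T..}. f ((t - T) + (T - t))) = sum f ((\<lambda>t. t - T) ` (A \<inter> {T..}))"
    by (subst sum.reindex) (auto simp: inj_on_def)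
  also have "\<dots> \<le> suminf f"
    using assms by (intro sum_le_suminf) auto
  finally have 1: "(\<Sum>t\<in>A \<inter> {T..}. f ((t - T) + (T - t))) \<le> suminf f" .
  have "(\<Sum>t\<in>A - {T..}. f ((t - T) + (T - t))) = sum f ((\<lambda>t. T - t) ` (A - {T..}))"
    by (subst sum.reindex) (auto simp: inj_on_def)
  also have "\<dots> \<le> suminf f"
    using assms by (intro sum_le_suminf) auto
  finally have "(\<Sum>t\<in>A - {T..}. f ((t - T) + (T - t))) \<le> suminf f" .
  then show ?thesis
    using 1 sum.Int_Diff[OF assms(3), of "\<lambda>t. f ((t - T) + (T - t))" "{T..}"] by linarith
qed

lemma poly_times_exp_bounded:
  obtains C where "0 < C" "\<And>n. real n ^ j * (2 powr (- real n / 8)) \<le> C"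
proof -
  have "(\<lambda>n. real n ^ j * (2 powr (- real n / 8))) \<longlonglongrightarrow> 0"
    by real_asymp
  then have "Bseq (\<lambda>n. real n ^ j * (2 powr (- real n / 8)))"
    by (intro convergent_imp_Bseq convergentI)
  then obtain C where "0 < C" "\<forall>n. norm (real n ^ j * (2 powr (- real n / 8))) \<le> C"
    by (rule BseqE)
  then show ?thesis
    by (intro that[of C]) auto
qed

text \<open>Beyond \<open>n / 8\<close> the repetition of the border alone leaves
  \<open>n - t\<close> free letters, which is exponentially small against \<open>k ^ n\<close> even
  after summing over fewer than \<open>n\<close> lengths.\<close>

lemma long_borders_le:
  assumes k: "2 \<le> k"
  shows "(\<Sum>t\<in>{t \<in> {1..<n}. n < 8 * t}.
           real (card {w \<in> words k n. privileged (take t w) \<and> closed_by w (take t w)}))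
         \<le> real k ^ n * (real n * 2 powr (- real n / 8))"
    (is "(\<Sum>t\<in>?A. real (card (?C t))) \<le> _")
proof -
  have "(\<Sum>t\<in>?A. real (card (?C t))) \<le> (\<Sum>t\<in>?A. real k ^ n * 2 powr (- real n / 8))"
  proof (rule sum_mono)
    fix t assume t: "t \<in> ?A"
    have "?C t \<subseteq> {w \<in> words k n. occurs_at (take t w) w (n - t)}"
      using t by (auto simp: words_def dest!: closed_byD(4))
    then have "card (?C t) \<le> card {w \<in> words k n. occurs_at (take t w) w (n - t)}"
      by (intro card_mono) auto
    also have "\<dots> \<le> k ^ (n - t)"
      using t by (intro card_words_with_border_le) auto
    finally have "real (card (?C t)) \<le> real (k ^ (n - t))"
      using of_nat_mono by blast
    also have "\<dots> \<le> real (k ^ n) * (1/2) ^ t"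
      using k t by (intro power_diff_le_half_power) auto
    also have "(1/2::real) ^ t = 2 powr (- real t)"
      by (simp add: powr_minus powr_realpow field_simps)
    also have "real (k ^ n) * 2 powr (- real t) \<le> real (k ^ n) * 2 powr (- real n / 8)"
      using t by (intro mult_left_mono powr_mono) auto
    finally show "real (card (?C t)) \<le> real k ^ n * 2 powr (- real n / 8)" by simp
  qed
  also have "\<dots> = real (card ?A) * (real k ^ n * 2 powr (- real n / 8))"
    by simp
  also have "\<dots> \<le> real n * (real k ^ n * 2 powr (- real n / 8))"
  proof (intro mult_right_mono)
    have "card ?A \<le> card {1..<n}" by (intro card_mono) auto
    then show "real (card ?A) \<le> real n" by simp
  qed simp
  finally show ?thesis by (simp add: mult_ac)
qed

text \<open>Here \<open>T\<close> is the integer part of the logarithm of \<open>n\<close>. Each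
  term is bounded by the term at \<open>T\<close>, times a polynomial in the distance of
  \<open>t\<close> and \<open>T\<close>, times 2 to minus that distance. The series over distances
  converges; counting it on both sides of \<open>T\<close> gives 256 = 2 * 128.\<close>

lemma short_borders_le:
  assumes k: "2 \<le> k" and T: "k ^ T \<le> n" "n < k ^ Suc T" "1 \<le> T"
    and c: "0 < c" "\<And>t. 1 \<le> t \<Longrightarrow> real (P k t) \<le> c * real k ^ t / itprod k 0 j (real t)"
  shows "(\<Sum>t\<in>{t \<in> {1..<n}. 8 * t \<le> n}.
           real (card {w \<in> words k n. privileged (take t w) \<and> closed_by w (take t w)}))
         \<le> real k ^ n * (256 * c * real k * (\<Sum>d. (1 + real d) ^ j * (1/2) ^ d)
              / (real n * itprod k 0 j (real T)))"
    (is "(\<Sum>t\<in>?A. real (card (?C t))) \<le> _ * (_ * suminf ?f / _)")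
proof -
  let ?G = "itprod k 0 j"
  define D where "D = c / ?G T * (128 * real k / real n)"
  have "0 < k ^ T" using k by simp
  then have n: "0 < real n" using T(1) by linarith
  have GT: "0 < ?G (real T)" using T by (intro itprod_pos) auto
  have "(\<Sum>t\<in>?A. real (card (?C t))) \<le> (\<Sum>t\<in>?A. real k ^ n * D * ?f ((t - T) + (T - t)))"
  proof (rule sum_mono)
    fix t assume t: "t \<in> ?A"
    let ?d = "(t - T) + (T - t)" and ?e = "exp (- real n / (8 * real (k ^ t)))"
    have Gt: "0 < ?G (real t)" using t by (intro itprod_pos) auto
    have "?G (real T) \<le> (1 + real (T - t)) ^ j * ?G (real t)"
      using itprod_shift_le[of k t T 0 j] k t T by simp
    also have "\<dots> \<le> (1 + real ?d) ^ j * ?G (real t)"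
      using Gt by (intro mult_right_mono power_mono) auto
    finally have G: "1 / ?G (real t) \<le> (1 + real ?d) ^ j / ?G (real T)"
      using Gt GT by (simp add: field_simps)
    have "real (card (?C t)) \<le> real (P k t) * (real (k ^ (n - 2 * t)) * ?e)"
      using k t by (intro card_closed_by_privileged_le) auto
    also have "\<dots> \<le> c * real k ^ t / ?G t * (real (k ^ (n - 2 * t)) * ?e)"
      using c(2)[of t] t by (intro mult_right_mono) auto
    also have "\<dots> = real k ^ n * c * (1 / ?G t) * (?e / real k ^ t)"
      using k t power_diff[of "real k" "2 * t" n] by (simp add: mult_2 power_add)
    also have "\<dots> \<le> real k ^ n * c * ((1 + real ?d) ^ j / ?G T) * (128 * real k / real n * (1/2) ^ ?d)"
      using G c(1) Gt GT exp_decay_le[OF k T(1,2)] by (intro mult_mono mult_left_mono) auto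
    also have "\<dots> = real k ^ n * D * ?f ?d"
      by (simp add: D_def)
    finally show "real (card (?C t)) \<le> real k ^ n * D * ?f ?d" .
  qed
  also have "\<dots> = real k ^ n * D * (\<Sum>t\<in>?A. ?f ((t - T) + (T - t)))"
    by (simp only: sum_distrib_left)
  also have "\<dots> \<le> real k ^ n * D * (2 * suminf ?f)"
  proof (rule mult_left_mono)
    show "(\<Sum>t\<in>?A. ?f ((t - T) + (T - t))) \<le> 2 * suminf ?f"
      by (rule sum_distance_le[OF summable_poly_half]) auto
    show "0 \<le> real k ^ n * D"
      using n GT c(1) by (simp add: D_def)
  qed
  also have "\<dots> = real k ^ n * (256 * c * real k * suminf ?f / (real n * ?G (real T)))"
    by (simp add: D_def mult_ac)
  finally show ?thesis .
qed

lemma P_le_power: "P k n \<le> k ^ n"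
  unfolding P_def card_words[symmetric] by (intro card_mono) auto

lemma itprod_Suc_le_power:
  assumes "2 \<le> k" "1 \<le> n"
  shows "itprod k 0 (Suc j) (real n) \<le> real n ^ Suc j"
  using itprod_of_nat_le[OF assms, of 0 "Suc j"] by simp

lemma P_upper_bound:
  assumes k: "2 \<le> k"
  shows "\<exists>c>0. \<forall>n\<ge>1. real (P k n) \<le> c * real k ^ n / itprod k 0 j (real n)"
proof (induction j)
  case 0
  have "real (P k n) \<le> real k ^ n" for n
    using P_le_power[of k n] by (metis of_nat_le_iff of_nat_power)
  then show ?case by (intro exI[of _ 1]) simp
next
  case (Suc j)
  then obtain c where c: "0 < c"
    and IH: "\<And>t. 1 \<le> t \<Longrightarrow> real (P k t) \<le> c * real k ^ t / itprod k 0 j (real t)"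
    by blast
  \<comment> \<open>One power of \<open>n\<close> counts the long border lengths; the other
    \<open>j + 1\<close> bound \<open>itprod k 0 (Suc j) n\<close>.\<close>
  obtain C where C: "0 < C" "\<And>n. real n ^ (j + 2) * (2 powr (- real n / 8)) \<le> C"
    using poly_times_exp_bounded[of "j + 2"] by blast
  let ?G = "itprod k 0 j" and ?G' = "itprod k 0 (Suc j)"
  define K where "K = 256 * c * real k * (\<Sum>d. (1 + real d) ^ j * (1/2) ^ d)"
  have K: "0 \<le> K"
    using c unfolding K_def by (intro mult_nonneg_nonneg suminf_nonneg summable_poly_half) auto
  \<comment> \<open>The summands pay for short borders, long borders and the lengths
    \<open>n < k\<close>, where \<open>T\<close> would be 0.\<close>
  define c' where "c' = K * 2 ^ j + C + real k ^ Suc j"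
  have "real (P k n) \<le> c' * real k ^ n / ?G' (real n)" if n: "1 \<le> n" for n
  proof -
    have G': "0 < ?G' (real n)" using n by (intro itprod_pos) simp
    have G'_le: "?G' (real n) \<le> real n ^ Suc j"
      using k n by (rule itprod_Suc_le_power)
    have "real (P k n) \<le> real k ^ n * (c' / ?G' (real n))"
    proof (cases "n < k")
      case True
      have "?G' (real n) \<le> real k ^ Suc j"
        using G'_le True power_mono[of "real n" "real k" "Suc j"] by simp
      also have "\<dots> \<le> c'" using K C(1) by (simp add: c'_def)
      finally have "1 \<le> c' / ?G' (real n)" using G' by simp
      then have "real k ^ n * 1 \<le> real k ^ n * (c' / ?G' (real n))"
        by (intro mult_left_mono) auto
      moreover have "real (P k n) \<le> real k ^ n"
        using P_le_power[of k n] by (metis of_nat_le_iff of_nat_power)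
      ultimately show ?thesis by linarith
    next
      case False
      obtain T where T: "k ^ T \<le> n" "n < k ^ Suc T"
        using ex_power_ivl1[OF k n] by auto
      have T1: "1 \<le> T"
        using False T(2) by (cases T) auto
      let ?C = "\<lambda>t. {w \<in> words k n. privileged (take t w) \<and> closed_by w (take t w)}"
      have short: "(\<Sum>t\<in>{t \<in> {1..<n}. 8 * t \<le> n}. real (card (?C t)))
          \<le> real k ^ n * (K * 2 ^ j / ?G' (real n))"
      proof -
        have "real n \<le> real k ^ Suc T"
          using T(2) by (metis less_imp_le of_nat_le_iff of_nat_power)
        then have "log k (real n) \<le> log k (real k ^ Suc T)"
          using k n by (subst log_le_cancel_iff) auto
        also have "\<dots> = real (Suc T)"
          using k by (simp add: log_nat_power del: power_Suc)
        \<comment> \<open>Uses \<open>Suc T \<le> 2 * T\<close>; the factor 2 becomes the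
          \<open>2 ^ j\<close> in \<open>c'\<close>.\<close>
        finally have "tlog k (real n) \<le> real 2 * real T"
          using T1 by (simp add: tlog_def)
        then have "?G (tlog k (real n)) \<le> ?G (real 2 * real T)"
          using k tlog_ge_1 by (intro itprod_mono)
        also have "\<dots> \<le> 2 ^ j * ?G (real T)"
          using itprod_scale_le[OF k, of 2 "real T" 0 j] T1 by simp
        finally have "?G' (real n) \<le> 2 ^ j * (real n * ?G (real T))"
          using n by simp
        then have "K * 2 ^ j / (2 ^ j * (real n * ?G (real T))) \<le> K * 2 ^ j / ?G' (real n)"
          using K G' n T1 itprod_pos[of "real T" k 0 j]
          by (intro divide_left_mono mult_pos_pos) auto
        then have "K / (real n * ?G (real T)) \<le> K * 2 ^ j / ?G' (real n)" by simp
        then have "real k ^ n * (K / (real n * ?G (real T))) \<le> real k ^ n * (K * 2 ^ j / ?G' (real n))"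
          by (intro mult_left_mono) auto
        then show ?thesis
          using short_borders_le[OF k T T1 c IH] unfolding K_def by linarith
      qed
      have long: "(\<Sum>t\<in>{t \<in> {1..<n}. n < 8 * t}. real (card (?C t)))
          \<le> real k ^ n * (C / ?G' (real n))"
      proof -
        have "real n * 2 powr (- real n / 8) \<le> C / real n ^ Suc j"
          using C(2)[of n] n by (simp add: field_simps power2_eq_square)
        also have "\<dots> \<le> C / ?G' (real n)"
          using C(1) G' G'_le n by (intro divide_left_mono mult_pos_pos) auto
        finally have "real k ^ n * (real n * 2 powr (- real n / 8)) \<le> real k ^ n * (C / ?G' (real n))"
          by (intro mult_left_mono) auto
        then show ?thesis using long_borders_le[OF k, of n] by linarith
      qed
      have "real (P k n) \<le> (\<Sum>t=1..<n. real (card (?C t)))"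
        using of_nat_mono[OF P_le_sum_borders[of n k], where 'a = real] False k by simp
      also have "\<dots> = (\<Sum>t\<in>{t \<in> {1..<n}. 8 * t \<le> n}. real (card (?C t)))
          + (\<Sum>t\<in>{t \<in> {1..<n}. n < 8 * t}. real (card (?C t)))"
        by (subst sum.union_disjoint[symmetric]) (auto intro!: sum.cong)
      also have "\<dots> \<le> real k ^ n * (K * 2 ^ j / ?G' (real n)) + real k ^ n * (C / ?G' (real n))"
        using short long by linarith
      also have "\<dots> = real k ^ n * ((K * 2 ^ j + C) / ?G' (real n))"
        by (simp only: add_divide_distrib distrib_left)
      also have "\<dots> \<le> real k ^ n * (c' / ?G' (real n))"
        using G' by (intro mult_left_mono divide_right_mono) (auto simp: c'_def)
      finally show ?thesis .
    qed
    then show ?thesis by (simp add: mult.commute)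
  qed
  moreover have "0 < c'"
    using K C(1) by (simp add: c'_def add_nonneg_pos add_pos_nonneg)
  ultimately show ?case by blast
qed

theorem theorem2:
  fixes k :: nat
  assumes "k \<ge> 2"
  shows "(\<forall>j::nat. \<exists>N::real. \<exists>c::real. N > 0 \<and> c > 0 \<and>
            (\<forall>n::nat. real n > N \<longrightarrow>
               real (P k n) \<ge> c * real k ^ n /
                 (real n * iterlog k j (real n) * (\<Prod>i=1..j. iterlog k i (real n)))))
       \<and> (\<forall>j::nat. \<exists>N::real. \<exists>c::real. N > 0 \<and> c > 0 \<and>
            (\<forall>n::nat. real n > N \<longrightarrow>
               real (P k n) \<le> c * real k ^ n /
                 (real n * (\<Prod>i=1..j. iterlog k i (real n)))))"
proof (intro conjI allI)
  fix j :: nat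
  obtain c N where c: "0 < c"
    and N: "\<And>n. N \<le> n \<Longrightarrow> c * real k ^ n / itprod k 2 j (real n) \<le> card (aperiodic_privileged k n)"
    using aperiodic_privileged_lower_bound[OF assms, of j] by blast
  obtain M where M: "\<And>n. M \<le> n \<Longrightarrow>
      itprod k 2 j (real n) = real n * iterlog k j (real n) * (\<Prod>i=1..j. iterlog k i (real n))"
    using eventually_itprod_eq[OF assms, of j] by (auto simp: eventually_sequentially)
  show "\<exists>N::real. \<exists>c::real. N > 0 \<and> c > 0 \<and>
      (\<forall>n::nat. real n > N \<longrightarrow> real (P k n) \<ge> c * real k ^ n /
         (real n * iterlog k j (real n) * (\<Prod>i=1..j. iterlog k i (real n))))"
  proof (intro exI conjI allI impI)
    show "0 < real (Suc (N + M))" "0 < c" using c by simp_all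
    fix n assume "real (Suc (N + M)) < real n"
    then have "N \<le> n" "M \<le> n" by simp_all
    then show "c * real k ^ n / (real n * iterlog k j (real n) * (\<Prod>i=1..j. iterlog k i (real n)))
        \<le> real (P k n)"
      using N[of n] M[of n] card_aperiodic_privileged_le[of k n] by simp
  qed
next
  fix j :: nat
  \<comment> \<open>Level \<open>Suc j\<close> is needed because \<open>n\<close> itself is the
    first factor of the product, followed by \<open>j\<close> logarithms.\<close>
  obtain c where c: "0 < c"
    and le: "\<And>n. 1 \<le> n \<Longrightarrow> real (P k n) \<le> c * real k ^ n / itprod k 0 (Suc j) (real n)"
    using P_upper_bound[OF assms, of "Suc j"] by blast
  obtain M where M: "\<And>n. M \<le> n \<Longrightarrow>
      itprod k 0 (Suc j) (real n) = real n * (\<Prod>i=1..j. iterlog k i (real n))"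
    using eventually_itprod_eq[OF assms, of j] by (auto simp: eventually_sequentially)
  show "\<exists>N::real. \<exists>c::real. N > 0 \<and> c > 0 \<and>
      (\<forall>n::nat. real n > N \<longrightarrow> real (P k n) \<le> c * real k ^ n /
         (real n * (\<Prod>i=1..j. iterlog k i (real n))))"
  proof (intro exI conjI allI impI)
    show "0 < real (Suc M)" "0 < c" using c by simp_all
    fix n assume "real (Suc M) < real n"
    then have "1 \<le> n" "M \<le> n" by simp_all
    then show "real (P k n) \<le> c * real k ^ n / (real n * (\<Prod>i=1..j. iterlog k i (real n)))"
      using le[of n] M[of n] by simp
  qed
qed

end
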